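(* Let $f:\mathbb{R}^n\times\mathbb{R}_+\to\mathbb{R}$, $(\mathbf{x},t)\mapsto f(\mathbf{x};t)$, be smooth and satisfy, for constants $0<m\le L$ and $C_0\ge 0$ and for all $\mathbf{x}\in\mathbb{R}^n$, $t\ge 0$, $$\nabla_{\mathbf{x}\mathbf{x}}f(\mathbf{x};t)\succeq m\mathbf{I},\qquad \|\nabla_{\mathbf{x}\mathbf{x}}f(\mathbf{x};t)\|\le L,\qquad \|\nabla_{t\mathbf{x}}f(\mathbf{x};t)\|\le C_0 .$$ Let $\mathbf{x}^*(t)=\arg\min_{\mathbf{x}\in\mathbb{R}^n}f(\mathbf{x};t)$. Let $\{\mathbf{x}_k\}_{k\in\mathbb{N}}$ be the sequence generated from $\mathbf{x}_0\in\mathbb{R}^n$ by the U-FOPC method (defined in the context) with sampling period $h>0$, sampling times $t_k$, stepsizes $\alpha,\beta>0$, parameter $\gamma\in[0,1]$, $P$ prediction steps and $C$ correction steps. Define $$\varrho_{\mathrm{P}}=\max\{|1-\alpha m|,|1-\alpha L|\},\qquad \varrho_{\mathrm{C}}=\max\{|1-\beta m|,|1-\beta L|\},$$ and suppose $\alpha<2/L$, $\beta<2/L$, and that $C$ is selected so that $$\tau_0:=\varrho_{\mathrm{C}}^{C}\left[\varrho_{\mathrm{P}}^{P}+(\varrho_{\mathrm{P}}^{P}+1)\Big(1-\gamma+\gamma\frac{2L}{m}\Big)\right]<1 .$$ Then the sequence $\{\|\mathbf{x}_k-\mathbf{x}^*(t_k)\|\}_{k\in\mathbb{N}}$ converges linearly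 with rate $\tau_0$ to an asymptotical error bound, and $$\limsup_{k\to\infty}\|\mathbf{x}_k-\mathbf{x}^*(t_k)\|=O(\varrho_{\mathrm{C}}^{C}h).$$
   Context: $\|\cdot\|$ is the Euclidean norm and the induced matrix norm. $\nabla_{\mathbf{x}}f$, $\nabla_{\mathbf{x}\mathbf{x}}f$ are the gradient and Hessian of $f$ with respect to $\mathbf{x}$, and $\nabla_{t\mathbf{x}}f\in\mathbb{R}^n$ is the partial derivative in $t$ of $\nabla_{\mathbf{x}}f$. Sampling times satisfy $t_k-t_{k-1}=h$ for $k\geq 1$, with $t_0\ge0$. Under the stated assumptions $\mathbf{x}^*(t)$ is unique for each $t$. U-FOPC (Unconstrained First-Order Prediction-Correction) method: given $\mathbf{x}_0$, $\gamma\in[0,1]$, stepsizes $\alpha,\beta>0$ and numbers of steps $P,C\in\mathbb{N}$, for $k=0,1,2,\dots$: (Prediction) set $\widehat{\mathbf{x}}^0=\mathbf{x}_k$; for $p=0,\dots,P-1$, $$\widehat{\mathbf{x}}^{p+1}=\widehat{\mathbf{x}}^{p}-\alpha\big(\nabla_{\mathbf{x}\mathbf{x}}f(\mathbf{x}_k;t_k)(\widehat{\mathbf{x}}^{p}-\mathbf{x}_k)+h\,\nabla_{t\mathbf{x}}f(\mathbf{x}_k;t_k)+\gamma\nabla_{\mathbf{x}}f(\mathbf{x}_k;t_k)\big);$$ set $\tilde{\mathbf{x}}_{k+1|k}=\widehat{\mathbf{x}}^{P}$. (Correction) reset $\widehat{\mathbf{x}}^0=\tilde{\mathbf{x}}_{k+1|k}$;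 for $c=0,\dots,C-1$, $$\widehat{\mathbf{x}}^{c+1}=\widehat{\mathbf{x}}^{c}-\beta\nabla_{\mathbf{x}}f(\widehat{\mathbf{x}}^{c};t_{k+1});$$ set $\mathbf{x}_{k+1}=\widehat{\mathbf{x}}^{C}$. A nonnegative sequence $\{e_k\}$ "converges linearly with rate $\tau$ to an asymptotical error bound" means there is a constant $b\ge0$ with $e_k\le\tau^k e_0+b$ for all $k$. The constant in $O(\cdot)$ does not depend on $h$, $k$ or $\mathbf{x}_0$; it may depend on $m$, $L$, $C_0$ and $\tau_0$. *)

theory Defs
  imports "HOL-Analysis.Analysis"
begin

text \<open>
  Derivatives are taken within S, hence one-sided at boundary points. For
  S = UNIV \<times> {0..} they are unique, so the existential only names the derivative.
\<close>

primrec Ck_on :: "nat \<Rightarrow> 'a::real_normed_vector set \<Rightarrow> ('a \<Rightarrow> 'b::real_normed_vector) \<Rightarrow> bool" where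
  "Ck_on 0 S g \<longleftrightarrow> continuous_on S g"
| "Ck_on (Suc k) S g \<longleftrightarrow>
     (\<exists>g'. (\<forall>x\<in>S. (g has_derivative g' x) (at x within S)) \<and> (\<forall>v. Ck_on k S (\<lambda>x. g' x v)))"

definition smooth_on :: "'a::real_normed_vector set \<Rightarrow> ('a \<Rightarrow> 'b::real_normed_vector) \<Rightarrow> bool" where
  "smooth_on S g \<longleftrightarrow> (\<forall>k. Ck_on k S g)"

definition gradient :: "(real^'n \<Rightarrow> real) \<Rightarrow> real^'n \<Rightarrow> real^'n" where
  "gradient g x = (THE D. GDERIV g x :> D)"

definition hessian :: "(real^'n \<Rightarrow> real) \<Rightarrow> real^'n \<Rightarrow> real^'n^'n" where
  "hessian g x = jacobian (gradient g) (at x)"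

definition grad_x :: "(real^'n \<Rightarrow> real \<Rightarrow> real) \<Rightarrow> real^'n \<Rightarrow> real \<Rightarrow> real^'n" where
  "grad_x f x t = gradient (\<lambda>y. f y t) x"

definition hess_xx :: "(real^'n \<Rightarrow> real \<Rightarrow> real) \<Rightarrow> real^'n \<Rightarrow> real \<Rightarrow> real^'n^'n" where
  "hess_xx f x t = hessian (\<lambda>y. f y t) x"

text \<open>At t = 0 this is the right derivative.\<close>

definition grad_tx :: "(real^'n \<Rightarrow> real \<Rightarrow> real) \<Rightarrow> real^'n \<Rightarrow> real \<Rightarrow> real^'n" where
  "grad_tx f x t = vector_derivative (\<lambda>s. grad_x f x s) (at t within {0..})"

text \<open>The order is only used for Hessians of smooth functions, so symmetry is not required here.\<close>

definition psd :: "real^'n^'n \<Rightarrow> bool" where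
  "psd A \<longleftrightarrow> (\<forall>v. 0 \<le> v \<bullet> (A *v v))"

definition loewner_ge :: "real^'n^'n \<Rightarrow> real^'n^'n \<Rightarrow> bool" where
  "loewner_ge A B \<longleftrightarrow> psd (A - B)"

definition minimizer :: "(real^'n \<Rightarrow> real \<Rightarrow> real) \<Rightarrow> real \<Rightarrow> real^'n" where
  "minimizer f t = (ARG_MIN (\<lambda>x. f x t) x. True)"

definition prediction_step ::
  "(real^'n \<Rightarrow> real \<Rightarrow> real) \<Rightarrow> real \<Rightarrow> real \<Rightarrow> real \<Rightarrow> real^'n \<Rightarrow> real \<Rightarrow> real^'n \<Rightarrow> real^'n" where
  "prediction_step f h \<alpha> \<gamma> xk tk y =
     y - \<alpha> *\<^sub>R (hess_xx f xk tk *v (y - xk) + h *\<^sub>R grad_tx f xk tk + \<gamma> *\<^sub>R grad_x f xk tk)"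

definition correction_step ::
  "(real^'n \<Rightarrow> real \<Rightarrow> real) \<Rightarrow> real \<Rightarrow> real \<Rightarrow> real^'n \<Rightarrow> real^'n" where
  "correction_step f \<beta> t y = y - \<beta> *\<^sub>R grad_x f y t"

primrec ufopc ::
  "(real^'n \<Rightarrow> real \<Rightarrow> real) \<Rightarrow> real \<Rightarrow> (nat \<Rightarrow> real) \<Rightarrow> real \<Rightarrow> real \<Rightarrow> real \<Rightarrow>
   nat \<Rightarrow> nat \<Rightarrow> real^'n \<Rightarrow> nat \<Rightarrow> real^'n" where
  "ufopc f h t \<alpha> \<beta> \<gamma> P C x0 0 = x0"
| "ufopc f h t \<alpha> \<beta> \<gamma> P C x0 (Suc k) =
     (let xk = ufopc f h t \<alpha> \<beta> \<gamma> P C x0 k;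
          pred = (prediction_step f h \<alpha> \<gamma> xk (t k) ^^ P) xk
      in (correction_step f \<beta> (t (Suc k)) ^^ C) pred)"

definition rate :: "real \<Rightarrow> real \<Rightarrow> real \<Rightarrow> real" where
  "rate m L s = max \<bar>1 - s * m\<bar> \<bar>1 - s * L\<bar>"

definition converges_linearly_to_error_bound :: "(nat \<Rightarrow> real) \<Rightarrow> real \<Rightarrow> bool" where
  "converges_linearly_to_error_bound e \<tau> \<longleftrightarrow> (\<exists>b\<ge>0. \<forall>k. e k \<le> \<tau> ^ k * e 0 + b)"

end

theory Submission
  imports Defs
begin

text \<open>
  Write \<open>e\<^sub>k\<close> for the distance of the \<open>k\<close>-th iterate from the minimizer \<open>x\<^sup>*(t\<^sub>k)\<close>.
  The theorem follows from the one-step inequality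
  \<open>e\<^sub>k\<^sub>+\<^sub>1 \<le> \<tau>\<^sub>0 e\<^sub>k + \<rho>\<^sub>C\<^sup>C 3 C\<^sub>0 h / m\<close> (\<open>ufopc_error_step\<close>): iterating it and summing
  the geometric series gives the linear bound, whose limit is the asymptotic error, with
  \<open>K = 3 C\<^sub>0 / (m (1 - \<tau>\<^sub>0))\<close>.

  For the prediction, let \<open>H\<close> and \<open>g\<close> be the Hessian and the gradient at the iterate
  \<open>x = x\<^sub>k\<close>, let \<open>d\<close> be the mixed derivative of \<open>f\<close> there, and let
  \<open>z = x\<^sup>*(t\<^sub>k)\<close>. The prediction iterates \<open>P\<close> times an affine map with linear part
  \<open>I - \<alpha>H\<close>, a contraction with factor \<open>\<rho>\<^sub>P\<close>, towards the fixed point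
  \<open>x' = x - H\<^sup>-\<^sup>1(h d + \<gamma> g)\<close>. That point is a damped Newton point with a drift:
  \<open>x' - z = (1 - \<gamma>)(x - z) + \<gamma> (x - z - H\<^sup>-\<^sup>1 g) - h H\<^sup>-\<^sup>1 d\<close>.
  As the gradient vanishes at \<open>z\<close> and Hessians at different points differ by at most \<open>2L\<close>,
  the middle term is at most \<open>\<gamma> (2L/m) e\<^sub>k\<close>, and the last one is at most \<open>h C\<^sub>0/m\<close>.
  This yields the bracket in \<open>\<tau>\<^sub>0\<close> (\<open>prediction_error_le\<close>) and an error of at most
  \<open>2 h C\<^sub>0/m\<close>. The move of the minimizer between two samples costs a third \<open>h C\<^sub>0/m\<close>
  (\<open>minimizer_drift_le\<close>), and each correction is a gradient step for a fixed function,
  which contracts distances to the minimizer by \<open>\<rho>\<^sub>C\<close>.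

  Both contraction factors rest on the bound of \<open>I - sH\<close> by
  \<open>max \<bar>1 - s m\<bar> \<bar>1 - s L\<bar>\<close>, which needs \<open>H\<close> to be symmetric. The symmetry is obtained from
  second differences (\<open>derivative_of_gradient_symmetric\<close>), and the norm bound from the
  polarization identity (\<open>norm_le_of_symmetric_form_le\<close>).
\<close>

section \<open>Symmetry of the second derivative\<close>

text \<open>
  One application of the mean value theorem in direction \<open>u\<close> reduces the second difference
  to a difference of gradients at two points close to \<open>x\<close>, and differentiability of the
  gradient at the single point \<open>x\<close> evaluates that up to \<open>o(r)\<close>. The second difference is
  symmetric in \<open>u\<close> and \<open>v\<close>, which makes the limit symmetric too.
\<close>

lemma second_difference_quotient_tendsto:
  fixes g :: "'a::real_inner \<Rightarrow> real"
  assumes g: "\<And>y. GDERIV g y :> G y" and G: "(G has_derivative D) (at x)"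
  shows "((\<lambda>r. (g (x + r *\<^sub>R u + r *\<^sub>R v) - g (x + r *\<^sub>R u) - g (x + r *\<^sub>R v) + g x) / r\<^sup>2)
           \<longlongrightarrow> D v \<bullet> u) (at_right 0)"
    (is "((\<lambda>r. ?\<Delta> r / r\<^sup>2) \<longlongrightarrow> _) _")
proof (rule tendstoI)
  fix e :: real
  assume "0 < e"
  interpret D: bounded_linear D
    using G by (rule has_derivative_bounded_linear)
  define N where "N = norm u + norm v"
  have N: "0 \<le> N" "norm u \<le> N" by (auto simp: N_def)
  \<comment> \<open>The final estimate is \<open>e' * (2 * N * norm u) < e\<close>; the \<open>+ 1\<close> covers \<open>u = 0\<close>.\<close>
  define e' where "e' = e / (2 * N * norm u + 1)"
  have den: "0 < 2 * N * norm u + 1"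
    using N by (simp add: add_nonneg_pos)
  have "0 < e'" unfolding e'_def using den \<open>0 < e\<close> by simp
  then obtain d where "0 < d"
    and d: "\<And>y. norm (y - x) < d \<Longrightarrow> norm (G y - G x - D (y - x)) \<le> e' * norm (y - x)"
    using G unfolding has_derivative_at_alt by blast
  have "dist (?\<Delta> r / r\<^sup>2) (D v \<bullet> u) < e" if r: "0 < r" "r < d / (N + 1)" for r
  proof -
    have rN: "r * N < d"
      using r N by (simp add: pos_less_divide_eq distrib_left)
    let ?\<psi> = "\<lambda>a. g (x + a *\<^sub>R u + r *\<^sub>R v) - g (x + a *\<^sub>R u)"
    have "\<exists>\<xi>\<in>{0<..<r}. ?\<psi> r - ?\<psi> 0
        = (\<lambda>b. (b *\<^sub>R u) \<bullet> G (x + \<xi> *\<^sub>R u + r *\<^sub>R v) - (b *\<^sub>R u) \<bullet> G (x + \<xi> *\<^sub>R u)) (r - 0)"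
    proof (rule mvt_simple[OF r(1)])
      fix a :: real
      have line: "((\<lambda>a. x + a *\<^sub>R u + w) has_derivative (\<lambda>b. b *\<^sub>R u)) (at a within {0..r})" for w
        by (auto intro!: derivative_eq_intros)
      show "(?\<psi> has_derivative
          (\<lambda>b. (b *\<^sub>R u) \<bullet> G (x + a *\<^sub>R u + r *\<^sub>R v) - (b *\<^sub>R u) \<bullet> G (x + a *\<^sub>R u))) (at a within {0..r})"
        using has_derivative_compose[OF line[of "r *\<^sub>R v"] g[unfolded gderiv_def]]
          has_derivative_compose[OF line[of 0] g[unfolded gderiv_def]]
        by (intro has_derivative_diff) simp_all
    qed
    then obtain \<xi> where \<xi>: "0 < \<xi>" "\<xi> < r"
      and "?\<psi> r - ?\<psi> 0 = r * (u \<bullet> (G (x + \<xi> *\<^sub>R u + r *\<^sub>R v) - G (x + \<xi> *\<^sub>R u)))"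
      by (auto simp: inner_diff_right algebra_simps)
    then have \<Delta>: "?\<Delta> r = r * (u \<bullet> (G (x + \<xi> *\<^sub>R u + r *\<^sub>R v) - G (x + \<xi> *\<^sub>R u)))"
      by simp
    have est: "norm (G (x + w) - G x - D w) \<le> e' * (r * N)" if w: "norm w \<le> r * N" for w
    proof -
      have "norm (G (x + w) - G x - D w) \<le> e' * norm w"
        using d[of "x + w"] w rN by simp
      also have "\<dots> \<le> e' * (r * N)"
        using w \<open>0 < e'\<close> by simp
      finally show ?thesis .
    qed
    have small: "norm (\<xi> *\<^sub>R u) \<le> r * norm u"
      using \<xi> by (simp add: mult_right_mono)
    have "norm (\<xi> *\<^sub>R u + r *\<^sub>R v) \<le> norm (\<xi> *\<^sub>R u) + norm (r *\<^sub>R v)"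
      by (rule norm_triangle_ineq)
    then have w1: "norm (\<xi> *\<^sub>R u + r *\<^sub>R v) \<le> r * N"
      using small r by (simp add: N_def distrib_left)
    have w2: "norm (\<xi> *\<^sub>R u) \<le> r * N"
      using small r N(2) by (meson mult_left_mono less_imp_le order_trans)
    define E where "E = G (x + \<xi> *\<^sub>R u + r *\<^sub>R v) - G (x + \<xi> *\<^sub>R u) - r *\<^sub>R D v"
    have split: "E = (G (x + (\<xi> *\<^sub>R u + r *\<^sub>R v)) - G x - D (\<xi> *\<^sub>R u + r *\<^sub>R v))
        - (G (x + \<xi> *\<^sub>R u) - G x - D (\<xi> *\<^sub>R u))"
      by (simp add: E_def D.add D.scaleR add.assoc)
    have E: "norm E \<le> 2 * e' * (r * N)"
      using order_trans[OF norm_triangle_ineq4 add_mono[OF est[OF w1] est[OF w2]]]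
      unfolding split by linarith
    have "?\<Delta> r = r * (u \<bullet> E) + r\<^sup>2 * (D v \<bullet> u)"
      unfolding \<Delta> E_def
      by (simp add: inner_diff_right inner_commute power2_eq_square right_diff_distrib)
    then have "?\<Delta> r / r\<^sup>2 - D v \<bullet> u = (u \<bullet> E) / r"
      using r(1) by (simp add: add_divide_distrib power2_eq_square)
    then have "dist (?\<Delta> r / r\<^sup>2) (D v \<bullet> u) = \<bar>u \<bullet> E\<bar> / r"
      using r(1) by (simp add: dist_real_def)
    also have "\<dots> \<le> norm u * (2 * e' * (r * N)) / r"
    proof (intro divide_right_mono)
      show "\<bar>u \<bullet> E\<bar> \<le> norm u * (2 * e' * (r * N))"
        using Cauchy_Schwarz_ineq2[of u E] mult_left_mono[OF E, of "norm u"] by simp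
    qed (use r in simp)
    also have "\<dots> = e' * (2 * N * norm u)"
      using r(1) by simp
    also have "\<dots> < e' * (2 * N * norm u + 1)"
      using \<open>0 < e'\<close> by simp
    also have "\<dots> = e"
      using den by (simp add: e'_def)
    finally show ?thesis .
  qed
  moreover have "0 < d / (N + 1)"
    using \<open>0 < d\<close> N by simp
  ultimately show "\<forall>\<^sub>F r in at_right 0. dist (?\<Delta> r / r\<^sup>2) (D v \<bullet> u) < e"
    unfolding eventually_at_right_field by auto
qed

lemma derivative_of_gradient_symmetric:
  fixes g :: "'a::real_inner \<Rightarrow> real"
  assumes g: "\<And>y. GDERIV g y :> G y" and G: "(G has_derivative D) (at x)"
  shows "D v \<bullet> u = D u \<bullet> v"
proof -
  have "(\<lambda>r. (g (x + r *\<^sub>R v + r *\<^sub>R u) - g (x + r *\<^sub>R v) - g (x + r *\<^sub>R u) + g x) / r\<^sup>2)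
      = (\<lambda>r. (g (x + r *\<^sub>R u + r *\<^sub>R v) - g (x + r *\<^sub>R u) - g (x + r *\<^sub>R v) + g x) / r\<^sup>2)"
    by (simp add: fun_eq_iff algebra_simps)
  with second_difference_quotient_tendsto[OF g G, of v u]
  have "((\<lambda>r. (g (x + r *\<^sub>R u + r *\<^sub>R v) - g (x + r *\<^sub>R u) - g (x + r *\<^sub>R v) + g x) / r\<^sup>2)
      \<longlongrightarrow> D u \<bullet> v) (at_right 0)"
    by simp
  then show ?thesis
    by (rule tendsto_unique[OF trivial_limit_at_right_real second_difference_quotient_tendsto[OF g G]])
qed

section \<open>Norms of symmetric operators\<close>

text \<open>
  Polarization bounds the bilinear form \<open>A a \<bullet> b\<close> by values of the quadratic form; the norm
  of \<open>A v\<close> is then read off by taking \<open>b\<close> in the direction of \<open>A v\<close>.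
\<close>

lemma norm_le_of_symmetric_form_le:
  fixes A :: "'a::real_inner \<Rightarrow> 'a"
  assumes A: "linear A" and sym: "\<And>u v. A u \<bullet> v = A v \<bullet> u"
    and form: "\<And>v. \<bar>v \<bullet> A v\<bar> \<le> \<rho> * (norm v)\<^sup>2"
  shows "norm (A v) \<le> \<rho> * norm v"
proof -
  have polar: "4 * (A a \<bullet> b) \<le> 2 * \<rho> * ((norm a)\<^sup>2 + (norm b)\<^sup>2)" for a b
  proof -
    have "4 * (A a \<bullet> b) = (a + b) \<bullet> A (a + b) - (a - b) \<bullet> A (a - b)"
      using sym[of a b]
      by (simp add: linear_add[OF A] linear_diff[OF A] inner_add_left inner_add_right
          inner_diff_left inner_diff_right inner_commute)
    also have "\<dots> \<le> \<rho> * (norm (a + b))\<^sup>2 + \<rho> * (norm (a - b))\<^sup>2"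
      using form[of "a + b"] form[of "a - b"] by linarith
    also have "\<dots> = 2 * \<rho> * ((norm a)\<^sup>2 + (norm b)\<^sup>2)"
      by (simp add: power2_norm_eq_inner inner_add_left inner_add_right inner_diff_left
          inner_diff_right inner_commute algebra_simps)
    finally show ?thesis .
  qed
  show ?thesis
  proof (cases "v = 0 \<or> A v = 0")
    case True
    have "0 \<le> \<rho> * norm v"
    proof (cases "v = 0")
      case False
      have "0 \<le> \<rho> * (norm v)\<^sup>2" using form[of v] by linarith
      with False show ?thesis by (simp add: zero_le_mult_iff)
    qed simp
    with True show ?thesis using linear_0[OF A] by auto
  next
    case False
    then have pos: "0 < norm v" "0 < norm (A v)" by auto
    \<comment> \<open>Scaled to the length of \<open>v\<close>, which makes the arithmetic mean in \<open>polar\<close> sharp.\<close>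
    define b where "b = (norm v / norm (A v)) *\<^sub>R A v"
    have b: "norm b = norm v" "A v \<bullet> b = norm v * norm (A v)"
      using pos by (simp_all add: b_def power2_norm_eq_inner[symmetric] power2_eq_square)
    have "4 * (norm v * norm (A v)) \<le> 4 * (norm v * (\<rho> * norm v))"
      using polar[of v b] b by (simp add: power2_eq_square algebra_simps)
    then show ?thesis using pos by simp
  qed
qed

section \<open>Strongly convex functions with bounded Hessian\<close>

lemma rate_nonneg: "0 \<le> rate m L s"
  by (simp add: rate_def)

lemma rate_less_one:
  assumes "0 < m" "m \<le> L" "0 < s" "s < 2 / L"
  shows "rate m L s < 1"
proof -
  have "0 < s * m" "s * m \<le> s * L" "s * L < 2"
    using assms by (simp_all add: pos_less_divide_eq)
  then show ?thesis by (simp add: rate_def abs_less_iff)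
qed

text \<open>
  This is \<open>f\<close> at one fixed time: \<open>G\<close> is its gradient and \<open>D x\<close> its Hessian at \<open>x\<close>,
  as a linear map. All steps of the method but the passage from \<open>t\<^sub>k\<close> to \<open>t\<^sub>k\<^sub>+\<^sub>1\<close>
  concern one such function.
\<close>

locale strongly_convex_smooth =
  fixes g :: "'a::euclidean_space \<Rightarrow> real" and G :: "'a \<Rightarrow> 'a" and D :: "'a \<Rightarrow> 'a \<Rightarrow> 'a"
    and m L :: real
  assumes m_pos: "0 < m" and m_le_L: "m \<le> L"
    and gradient: "\<And>x. GDERIV g x :> G x"
    and derivative: "\<And>x. (G has_derivative D x) (at x)"
    and lower: "\<And>x v. m * (norm v)\<^sup>2 \<le> v \<bullet> D x v"
    and upper: "\<And>x v. norm (D x v) \<le> L * norm v"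
begin

lemma linear_D: "linear (D x)"
  using derivative by (rule has_derivative_linear)

lemma norm_D_ge: "m * norm v \<le> norm (D x v)"
proof (cases "v = 0")
  case False
  have "m * norm v * norm v \<le> norm (D x v) * norm v"
    using lower[of v x] norm_cauchy_schwarz[of v "D x v"] by (simp add: power2_eq_square mult_ac)
  with False show ?thesis by simp
qed simp

lemma surj_D: "surj (D x)"
proof (rule linear_injective_imp_surjective[OF linear_D])
  show "inj (D x)"
  proof (subst linear_injective_0[OF linear_D], safe)
    fix v assume "D x v = 0"
    then have "m * norm v \<le> 0" using norm_D_ge[of v x] by simp
    then show "v = 0" using m_pos by (simp add: mult_le_0_iff)
  qed
qed simp

text \<open>
  The quadratic form of \<open>I - s D x\<close> lies between \<open>1 - s L\<close> and \<open>1 - s m\<close> times the squared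
  norm, and the operator is symmetric because \<open>D x\<close> is a second derivative.
\<close>

lemma norm_step_le:
  assumes "0 \<le> s"
  shows "norm (v - s *\<^sub>R D x v) \<le> rate m L s * norm v"
proof (rule norm_le_of_symmetric_form_le)
  show "linear (\<lambda>v. v - s *\<^sub>R D x v)"
    using linear_D[of x] by (simp add: linear_compose_sub linear_compose_scale_right linear_ident)
  show "(u - s *\<^sub>R D x u) \<bullet> v = (v - s *\<^sub>R D x v) \<bullet> u" for u v
    using derivative_of_gradient_symmetric[OF gradient derivative, of x u v]
    by (simp add: inner_diff_left inner_diff_right inner_commute)
  show "\<bar>v \<bullet> (v - s *\<^sub>R D x v)\<bar> \<le> rate m L s * (norm v)\<^sup>2" for v
  proof -
    have "v \<bullet> D x v \<le> norm v * (L * norm v)"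
      using norm_cauchy_schwarz[of v "D x v"] upper[of x v]
      by (meson mult_left_mono norm_ge_zero order_trans)
    then have "s * (v \<bullet> D x v) \<le> s * (L * (norm v)\<^sup>2)"
      using assms by (intro mult_left_mono) (simp_all add: power2_eq_square mult_ac)
    moreover have "s * (m * (norm v)\<^sup>2) \<le> s * (v \<bullet> D x v)"
      using assms lower by (intro mult_left_mono)
    moreover have "v \<bullet> (v - s *\<^sub>R D x v) = (norm v)\<^sup>2 - s * (v \<bullet> D x v)"
      by (simp add: inner_diff_right power2_norm_eq_inner)
    ultimately have "v \<bullet> (v - s *\<^sub>R D x v) \<le> (1 - s * m) * (norm v)\<^sup>2"
      "(1 - s * L) * (norm v)\<^sup>2 \<le> v \<bullet> (v - s *\<^sub>R D x v)"
      by (simp_all add: left_diff_distrib mult.assoc)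
    moreover have "(1 - s * m) * (norm v)\<^sup>2 \<le> rate m L s * (norm v)\<^sup>2"
      "- rate m L s * (norm v)\<^sup>2 \<le> (1 - s * L) * (norm v)\<^sup>2"
      by (rule mult_right_mono; auto simp: rate_def)+
    ultimately show ?thesis by linarith
  qed
qed

lemma gradient_step_contracts:
  assumes "0 \<le> s"
  shows "norm ((x - s *\<^sub>R G x) - (y - s *\<^sub>R G y)) \<le> rate m L s * norm (x - y)"
proof (rule differentiable_bound[where S = UNIV])
  show "((\<lambda>x. x - s *\<^sub>R G x) has_derivative (\<lambda>v. v - s *\<^sub>R D x v)) (at x within UNIV)" for x
    using derivative[of x] by (auto intro!: derivative_eq_intros)
  show "onorm (\<lambda>v. v - s *\<^sub>R D x v) \<le> rate m L s" for x
    by (rule onorm_le) (rule norm_step_le[OF assms])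
qed auto

text \<open>
  This measures how far a Newton step at \<open>x\<close> is from being exact. The constant \<open>2 * L\<close> is
  the crude triangle bound for the difference of two Hessians.
\<close>

lemma linearization_error_le:
  "norm ((D x a - G a) - (D x b - G b)) \<le> 2 * L * norm (a - b)"
proof (rule differentiable_bound[where S = UNIV])
  interpret D: bounded_linear "D x"
    using derivative by (rule has_derivative_bounded_linear)
  show "((\<lambda>a. D x a - G a) has_derivative (\<lambda>v. D x v - D y v)) (at y within UNIV)" for y
    using derivative[of y] D.has_derivative[OF has_derivative_ident] 
    by (auto intro!: has_derivative_diff)
  show "onorm (\<lambda>v. D x v - D y v) \<le> 2 * L" for y
  proof (rule onorm_le)
    show "norm (D x v - D y v) \<le> 2 * L * norm v" for v
      using norm_triangle_ineq4[of "D x v" "D y v"] upper[of x v] upper[of y v] by simp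
  qed
qed auto

lemma gradient_strongly_monotone:
  "m * (norm (y - x))\<^sup>2 \<le> (G y - G x) \<bullet> (y - x)"
proof -
  have "\<exists>\<xi>\<in>{0<..<1}. G (x + 1 *\<^sub>R (y - x)) \<bullet> (y - x) - G (x + 0 *\<^sub>R (y - x)) \<bullet> (y - x)
      = (\<lambda>b. D (x + \<xi> *\<^sub>R (y - x)) (b *\<^sub>R (y - x)) \<bullet> (y - x)) (1 - 0)"
  proof (rule mvt_simple)
    fix a :: real
    have "((\<lambda>a. x + a *\<^sub>R (y - x)) has_derivative (\<lambda>b. b *\<^sub>R (y - x))) (at a within {0..1})"
      by (auto intro!: derivative_eq_intros)
    from has_derivative_inner_left[OF has_derivative_compose[OF this derivative]]
    show "((\<lambda>a. G (x + a *\<^sub>R (y - x)) \<bullet> (y - x)) has_derivative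
        (\<lambda>b. D (x + a *\<^sub>R (y - x)) (b *\<^sub>R (y - x)) \<bullet> (y - x))) (at a within {0..1})" .
  qed simp
  then obtain \<xi> where eq: "G y \<bullet> (y - x) - G x \<bullet> (y - x) = D (x + \<xi> *\<^sub>R (y - x)) (y - x) \<bullet> (y - x)"
    by auto
  have "m * (norm (y - x))\<^sup>2 \<le> D (x + \<xi> *\<^sub>R (y - x)) (y - x) \<bullet> (y - x)"
    using lower by (subst inner_commute)
  then show ?thesis
    by (simp only: inner_diff_left eq[symmetric])
qed

lemma norm_gradient_diff_ge: "m * norm (y - x) \<le> norm (G y - G x)"
proof (cases "y = x")
  case False
  have "m * norm (y - x) * norm (y - x) \<le> norm (G y - G x) * norm (y - x)"
    using gradient_strongly_monotone[of y x] norm_cauchy_schwarz[of "G y - G x" "y - x"]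
    by (simp add: power2_eq_square mult_ac)
  with False show ?thesis by simp
qed simp

text \<open>
  With step size \<open>1 / L\<close> the gradient step is a strict contraction of the whole space, and its
  fixed point is a stationary point.
\<close>

lemma stationary_point_exists: "\<exists>z. G z = 0"
proof -
  have L: "0 < L" using m_pos m_le_L by simp
  have "\<exists>!z. z - (1 / L) *\<^sub>R G z = z"
  proof (rule banach_fix_type)
    show "rate m L (1 / L) < 1"
      using m_pos m_le_L L by (intro rate_less_one) (simp_all add: divide_strict_right_mono)
    show "\<forall>x y. dist (x - (1 / L) *\<^sub>R G x) (y - (1 / L) *\<^sub>R G y) \<le> rate m L (1 / L) * dist x y"
      using gradient_step_contracts[of "1 / L"] L by (simp add: dist_norm)
  qed (rule rate_nonneg)
  with L show ?thesis by auto
qed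

text \<open>
  Along the segment from \<open>z\<close> to \<open>y\<close> the directional derivative is positive, by strong
  monotonicity of the gradient and its vanishing at \<open>z\<close>.
\<close>

lemma stationary_point_strict_minimum:
  assumes z: "G z = 0" and "y \<noteq> z"
  shows "g z < g y"
proof -
  have "\<exists>\<xi>\<in>{0<..<1}. g (z + 1 *\<^sub>R (y - z)) - g (z + 0 *\<^sub>R (y - z))
      = (\<lambda>b. (b *\<^sub>R (y - z)) \<bullet> G (z + \<xi> *\<^sub>R (y - z))) (1 - 0)"
  proof (rule mvt_simple)
    fix a :: real
    have "((\<lambda>a. z + a *\<^sub>R (y - z)) has_derivative (\<lambda>b. b *\<^sub>R (y - z))) (at a within {0..1})"
      by (auto intro!: derivative_eq_intros)
    from has_derivative_compose[OF this gradient[unfolded gderiv_def]]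
    show "((\<lambda>a. g (z + a *\<^sub>R (y - z))) has_derivative
        (\<lambda>b. (b *\<^sub>R (y - z)) \<bullet> G (z + a *\<^sub>R (y - z)))) (at a within {0..1})" .
  qed simp
  then obtain \<xi> where \<xi>: "0 < \<xi>" and eq: "g y - g z = (y - z) \<bullet> G (z + \<xi> *\<^sub>R (y - z))"
    by auto
  have "0 < m * (norm (\<xi> *\<^sub>R (y - z)))\<^sup>2"
    using m_pos \<xi> \<open>y \<noteq> z\<close> by simp
  also have "\<dots> \<le> \<xi> * ((y - z) \<bullet> G (z + \<xi> *\<^sub>R (y - z)))"
    using gradient_strongly_monotone[of "z + \<xi> *\<^sub>R (y - z)" z] z by (simp add: inner_commute)
  finally show ?thesis
    using eq \<xi> by (simp add: zero_less_mult_iff)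
qed

text \<open>
  The stationary point is the only minimizer, so it is the point that the choice operator
  behind \<open>ARG_MIN\<close> selects.
\<close>

lemma gradient_arg_min_eq_0: "G (ARG_MIN g x. True) = 0"
proof -
  obtain z where z: "G z = 0" using stationary_point_exists by blast
  have "(ARG_MIN g x. True) = z"
    unfolding arg_min_def is_arg_min_def
  proof (rule some_equality)
    show "True \<and> \<not> (\<exists>y. True \<and> g y < g z)"
      using stationary_point_strict_minimum[OF z] by (metis less_asym less_irrefl)
    show "x = z" if "True \<and> \<not> (\<exists>y. True \<and> g y < g x)" for x
      using stationary_point_strict_minimum[OF z] that by blast
  qed
  with z show ?thesis by simp
qed

lemma gradient_descent_error_le:
  assumes z: "G z = 0" and "0 \<le> s"
  shows "norm (((\<lambda>y. y - s *\<^sub>R G y) ^^ n) x - z) \<le> rate m L s ^ n * norm (x - z)"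
proof (induction n)
  case (Suc n)
  let ?y = "((\<lambda>y. y - s *\<^sub>R G y) ^^ n) x"
  have "norm (?y - s *\<^sub>R G ?y - z) \<le> rate m L s * norm (?y - z)"
    using gradient_step_contracts[OF \<open>0 \<le> s\<close>, of ?y z] z by simp
  also have "\<dots> \<le> rate m L s * (rate m L s ^ n * norm (x - z))"
    using Suc rate_nonneg by (rule mult_left_mono)
  finally show ?case by (simp add: mult.assoc)
qed simp

text \<open>
  The vector \<open>c\<close> stands for \<open>h\<close> times the mixed derivative. The iterates approach
  \<open>x' = x - q\<close>, where \<open>q\<close> solves the linear system of the prediction, and the error splits
  into the distance of the \<open>n\<close>-th iterate from \<open>x'\<close> and that of \<open>x'\<close> from \<open>z\<close>.
\<close>

lemma prediction_error_le:
  assumes z: "G z = 0" and "0 \<le> \<alpha>" and \<gamma>: "0 \<le> \<gamma>" "\<gamma> \<le> 1"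
  shows "norm (((\<lambda>y. y - \<alpha> *\<^sub>R (D x (y - x) + c + \<gamma> *\<^sub>R G x)) ^^ n) x - z)
    \<le> (rate m L \<alpha> ^ n + (rate m L \<alpha> ^ n + 1) * (1 - \<gamma> + \<gamma> * (2 * L / m))) * norm (x - z)
      + (rate m L \<alpha> ^ n + 1) * (norm c / m)"
    (is "norm ((?T ^^ n) x - z) \<le> _")
proof -
  define r where "r = rate m L \<alpha> ^ n"
  have r: "0 \<le> r" by (simp add: r_def rate_nonneg)
  obtain q where q: "D x q = c + \<gamma> *\<^sub>R G x"
    using surj_D[of x] by (metis surjD)
  define x' where "x' = x - q"
  have step: "?T y - x' = (y - x') - \<alpha> *\<^sub>R D x (y - x')" for y
  proof -
    have "D x (y - x') = D x (y - x) + D x q"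
      by (simp add: x'_def linear_add[OF linear_D, symmetric] algebra_simps)
    then show ?thesis by (simp add: q algebra_simps)
  qed
  have inner: "norm ((?T ^^ n) x - x') \<le> r * norm (x - x')"
    unfolding r_def
  proof (induction n)
    case (Suc n)
    have "norm (?T ((?T ^^ n) x) - x') \<le> rate m L \<alpha> * norm ((?T ^^ n) x - x')"
      unfolding step using \<open>0 \<le> \<alpha>\<close> by (rule norm_step_le)
    also have "\<dots> \<le> rate m L \<alpha> * (rate m L \<alpha> ^ n * norm (x - x'))"
      using Suc rate_nonneg by (rule mult_left_mono)
    finally show ?case by (simp add: mult.assoc)
  qed simp
  \<comment> \<open>Splitting off \<open>(1 - \<gamma>) *\<^sub>R (x - z)\<close> before applying \<open>D x\<close> gives this part the factor
    \<open>1 - \<gamma>\<close>; estimating it through \<open>D x\<close> would cost an extra factor \<open>L / m\<close>.\<close>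
  define w where "w = x' - z - (1 - \<gamma>) *\<^sub>R (x - z)"
  have Dw: "D x w = \<gamma> *\<^sub>R ((D x x - G x) - (D x z - G z)) - c"
  proof -
    have "w = \<gamma> *\<^sub>R (x - z) - q"
      by (simp add: w_def x'_def algebra_simps)
    then have "D x w = \<gamma> *\<^sub>R (D x x - D x z) - D x q"
      by (simp only: linear_diff[OF linear_D] linear_scale[OF linear_D])
    then show ?thesis
      by (simp add: q z algebra_simps)
  qed
  have "m * norm w \<le> norm (D x w)"
    by (rule norm_D_ge)
  also have "\<dots> \<le> \<gamma> * norm ((D x x - G x) - (D x z - G z)) + norm c"
    unfolding Dw using norm_triangle_ineq4 \<gamma> by (metis abs_of_nonneg norm_scaleR)
  also have "\<dots> \<le> \<gamma> * (2 * L * norm (x - z)) + norm c"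
    using \<gamma>(1) linearization_error_le by (simp add: mult_left_mono)
  finally have w: "norm w \<le> \<gamma> * (2 * L / m) * norm (x - z) + norm c / m"
    using m_pos by (simp add: field_simps)
  have "norm (x' - z) \<le> norm ((1 - \<gamma>) *\<^sub>R (x - z)) + norm w"
    using norm_triangle_ineq[of "(1 - \<gamma>) *\<^sub>R (x - z)" w] by (simp add: w_def)
  then have x': "norm (x' - z) \<le> (1 - \<gamma> + \<gamma> * (2 * L / m)) * norm (x - z) + norm c / m"
    using w \<gamma> by (simp add: distrib_right)
  have "norm ((?T ^^ n) x - z) \<le> norm ((?T ^^ n) x - x') + norm (x' - z)"
    using norm_triangle_ineq[of "(?T ^^ n) x - x'" "x' - z"] by simp
  also have "\<dots> \<le> r * (norm (x - z) + norm (x' - z)) + norm (x' - z)"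
  proof -
    have "norm (x - x') \<le> norm (x - z) + norm (x' - z)"
      using norm_triangle_ineq4[of "x - z" "x' - z"] by simp
    then show ?thesis using inner r by (meson add_right_mono mult_left_mono order_trans)
  qed
  also have "\<dots> = r * norm (x - z) + (r + 1) * norm (x' - z)"
    by (simp add: algebra_simps)
  also have "\<dots> \<le> r * norm (x - z)
      + (r + 1) * ((1 - \<gamma> + \<gamma> * (2 * L / m)) * norm (x - z) + norm c / m)"
    using x' r by (intro add_left_mono mult_left_mono) auto
  also have "\<dots> = (r + (r + 1) * (1 - \<gamma> + \<gamma> * (2 * L / m))) * norm (x - z) + (r + 1) * (norm c / m)"
    by (simp add: algebra_simps)
  finally show ?thesis unfolding r_def .
qed

end

section \<open>Scalar recursions\<close>

lemma affine_recursion_le: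
  fixes e :: "nat \<Rightarrow> real"
  assumes "0 \<le> \<tau>" "\<tau> < 1" "0 \<le> c" and step: "\<And>k. e (Suc k) \<le> \<tau> * e k + c"
  shows "e k \<le> \<tau> ^ k * e 0 + c / (1 - \<tau>)"
proof (induction k)
  case (Suc k)
  have "e (Suc k) \<le> \<tau> * (\<tau> ^ k * e 0 + c / (1 - \<tau>)) + c"
    using step[of k] mult_left_mono[OF Suc \<open>0 \<le> \<tau>\<close>] by linarith
  also have "\<dots> = \<tau> ^ Suc k * e 0 + c / (1 - \<tau>)"
    using \<open>\<tau> < 1\<close> by (simp add: field_simps)
  finally show ?case .
qed (use assms in simp)

lemma limsup_le_of_geometric_bound:
  fixes e :: "nat \<Rightarrow> real"
  assumes "0 \<le> \<tau>" "\<tau> < 1" and bound: "\<And>k. e k \<le> \<tau> ^ k * a + b"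
  shows "limsup (\<lambda>k. ereal (e k)) \<le> ereal b"
proof -
  have "(\<lambda>k. \<tau> ^ k * a + b) \<longlonglongrightarrow> 0 * a + b"
    using assms by (intro tendsto_intros LIMSEQ_realpow_zero) auto
  then have "limsup (\<lambda>k. ereal (\<tau> ^ k * a + b)) = ereal b"
    by (intro lim_imp_Limsup) auto
  moreover have "limsup (\<lambda>k. ereal (e k)) \<le> limsup (\<lambda>k. ereal (\<tau> ^ k * a + b))"
    using bound by (intro Limsup_mono) auto
  ultimately show ?thesis by simp
qed

section \<open>Derivatives of a smooth time-varying function\<close>

text \<open>
  Freezing the time or the space variable is the special case of an affine embedding. Since the
  derivatives are taken within the set \<open>S\<close>, this also covers the boundary time \<open>0\<close>.
\<close>

lemma Ck_on_compose_affine: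
  assumes "Ck_on k S F" and l: "bounded_linear l" and sub: "\<And>x. x \<in> T \<Longrightarrow> a + l x \<in> S"
  shows "Ck_on k T (\<lambda>x. F (a + l x))"
  using assms(1)
proof (induction k arbitrary: F)
  case 0
  have "continuous_on T (\<lambda>x. a + l x)"
    using l by (intro continuous_intros linear_continuous_on)
  then show ?case
    using 0 sub by (auto intro: continuous_on_compose2[of S F])
next
  case (Suc k)
  then obtain F' where F': "\<And>x. x \<in> S \<Longrightarrow> (F has_derivative F' x) (at x within S)"
    and smooth: "\<And>v. Ck_on k S (\<lambda>x. F' x v)"
    by auto
  have "((\<lambda>x. F (a + l x)) has_derivative (\<lambda>v. F' (a + l x) (l v))) (at x within T)" if "x \<in> T" for x
  proof (rule has_derivative_in_compose2[OF F'])
    show "((\<lambda>x. a + l x) has_derivative l) (at x within T)"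
      using bounded_linear_imp_has_derivative[OF l] by (auto intro!: derivative_eq_intros)
  qed (use that sub in auto)
  moreover have "Ck_on k T (\<lambda>x. F' (a + l x) (l v))" for v
    using Suc.IH[OF smooth] .
  ultimately show ?case
    unfolding Ck_on.simps by (intro exI[of _ "\<lambda>x v. F' (a + l x) (l v)"]) simp
qed

lemma Ck_on_Suc_imp_differentiable:
  assumes "Ck_on (Suc k) S F" "x \<in> S"
  shows "F differentiable (at x within S)"
  using assms unfolding differentiable_def by auto

lemma gradient_eq: "GDERIV g x :> d \<Longrightarrow> gradient g x = d"
  unfolding gradient_def
proof (rule the_equality)
  fix d' assume "GDERIV g x :> d" "GDERIV g x :> d'"
  then have "(\<lambda>v. v \<bullet> d) = (\<lambda>v. v \<bullet> d')"
    unfolding gderiv_def by (rule has_derivative_unique)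
  then show "d' = d"
    by (metis vector_eq_ldot)
qed

text \<open>
  The spatial gradient is the restriction of the joint derivative to spatial directions. Its
  regularity in space and in time is therefore that of the joint derivative along a fixed
  direction \<open>(v, 0)\<close>, which is what \<open>Ck_on\<close> speaks about.
\<close>

lemma grad_x_via_joint_derivative:
  fixes f :: "real^'n \<Rightarrow> real \<Rightarrow> real"
  assumes F': "((\<lambda>(x, s). f x s) has_derivative F') (at (x, s) within UNIV \<times> {0..})" and "0 \<le> s"
  shows "GDERIV (\<lambda>y. f y s) x :> grad_x f x s"
    and "grad_x f x s \<bullet> v = F' (v, 0)"
proof -
  have "((\<lambda>y. (y, s)) has_derivative (\<lambda>v. (v, 0))) (at x)"
    by (auto intro!: derivative_eq_intros)
  moreover have "((\<lambda>(x, s). f x s) has_derivative F') (at (x, s) within range (\<lambda>y. (y, s)))"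
    using F' by (rule has_derivative_subset) (use \<open>0 \<le> s\<close> in auto)
  ultimately have der: "((\<lambda>y. f y s) has_derivative (\<lambda>v. F' (v, 0))) (at x)"
    using has_derivative_in_compose[of "\<lambda>y. (y, s)" "\<lambda>v. (v, 0)" x UNIV "\<lambda>(x, s). f x s" F'] by simp
  define d where "d = (\<Sum>i\<in>Basis. F' (i, 0) *\<^sub>R i)"
  have lin: "linear (\<lambda>v. F' (v, 0))"
    using der by (rule has_derivative_linear)
  have d: "v \<bullet> d = F' (v, 0)" for v
  proof -
    have "v \<bullet> d = (\<Sum>i\<in>Basis. (v \<bullet> i) *\<^sub>R F' (i, 0))"
      by (simp add: d_def inner_sum_right mult.commute)
    also have "\<dots> = F' (\<Sum>i\<in>Basis. (v \<bullet> i) *\<^sub>R i, 0)"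
      by (simp add: linear_sum[OF lin] linear_scale[OF lin])
    finally show ?thesis by (simp add: euclidean_representation)
  qed
  have "GDERIV (\<lambda>y. f y s) x :> d"
    unfolding gderiv_def d by (rule der)
  moreover from gradient_eq[OF this] have "grad_x f x s = d"
    by (simp add: grad_x_def)
  ultimately show "GDERIV (\<lambda>y. f y s) x :> grad_x f x s" "grad_x f x s \<bullet> v = F' (v, 0)"
    using d[of v] by (simp_all add: inner_commute)
qed

lemma smooth_derivatives:
  fixes f :: "real^'n \<Rightarrow> real \<Rightarrow> real"
  assumes "smooth_on (UNIV \<times> {0..}) (\<lambda>(x, s). f x s)" and s: "0 \<le> s"
  shows "GDERIV (\<lambda>y. f y s) x :> grad_x f x s"
    and "((\<lambda>y. grad_x f y s) has_derivative (*v) (hess_xx f x s)) (at x)"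
    and "((\<lambda>s. grad_x f x s) has_vector_derivative grad_tx f x s) (at s within {0..})"
proof -
  let ?S = "UNIV \<times> {0..} :: ((real^'n) \<times> real) set"
  have "Ck_on (Suc (Suc 0)) ?S (\<lambda>(x, s). f x s)"
    using assms unfolding smooth_on_def by blast
  then obtain F' where F': "\<And>p. p \<in> ?S \<Longrightarrow> ((\<lambda>(x, s). f x s) has_derivative F' p) (at p within ?S)"
    and smooth: "\<And>v. Ck_on (Suc 0) ?S (\<lambda>p. F' p v)"
    unfolding Ck_on.simps(2)[of "Suc 0"] by blast
  show "GDERIV (\<lambda>y. f y s) x :> grad_x f x s"
    using F'[of "(x, s)"] s by (auto intro: grad_x_via_joint_derivative)
  have grad: "grad_x f y r \<bullet> v = F' (y, r) (v, 0)" if "0 \<le> r" for y r v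
    using F'[of "(y, r)"] that by (auto intro: grad_x_via_joint_derivative)
  have "(\<lambda>y. grad_x f y s) differentiable (at x)"
  proof (subst differentiable_componentwise_within, intro ballI)
    fix i :: "real^'n"
    have "Ck_on (Suc 0) UNIV (\<lambda>y. F' ((0, s) + (y, 0)) (i, 0))"
      by (rule Ck_on_compose_affine[OF smooth]) (use s in \<open>auto intro!: bounded_linear_intros\<close>)
    from Ck_on_Suc_imp_differentiable[OF this, of x]
    show "(\<lambda>y. grad_x f y s \<bullet> i) differentiable (at x)"
      by (simp add: grad[OF s])
  qed
  then show "((\<lambda>y. grad_x f y s) has_derivative (*v) (hess_xx f x s)) (at x)"
    unfolding jacobian_works hess_xx_def hessian_def grad_x_def .
  have "(\<lambda>r. grad_x f x r) differentiable (at s within {0..})"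
  proof (subst differentiable_componentwise_within, intro ballI)
    fix i :: "real^'n"
    have "Ck_on (Suc 0) {0..} (\<lambda>r. F' ((x, 0) + (0, r)) (i, 0))"
      by (rule Ck_on_compose_affine[OF smooth]) (auto intro!: bounded_linear_intros)
    from Ck_on_Suc_imp_differentiable[OF this, of s] s
    have "(\<lambda>r. F' (x, r) (i, 0)) differentiable (at s within {0..})"
      by simp
    then show "(\<lambda>r. grad_x f x r \<bullet> i) differentiable (at s within {0..})"
      by (rule differentiable_transform_within[where d = 1]) (use s in \<open>auto simp: grad\<close>)
  qed
  then show "((\<lambda>s. grad_x f x s) has_vector_derivative grad_tx f x s) (at s within {0..})"
    unfolding grad_tx_def by (simp add: vector_derivative_works)
qed

lemma strongly_convex_smooth_slice:
  fixes f :: "real^'n \<Rightarrow> real \<Rightarrow> real"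
  assumes smooth: "smooth_on (UNIV \<times> {0..}) (\<lambda>(x, s). f x s)" and "0 < m" "m \<le> L" and s: "0 \<le> s"
    and lower: "\<And>x. loewner_ge (hess_xx f x s) (m *\<^sub>R mat 1)"
    and upper: "\<And>x. onorm ((*v) (hess_xx f x s)) \<le> L"
  shows "strongly_convex_smooth (\<lambda>x. f x s) (\<lambda>x. grad_x f x s) (\<lambda>x. (*v) (hess_xx f x s)) m L"
proof
  show "m * (norm v)\<^sup>2 \<le> v \<bullet> (hess_xx f x s *v v)" for x v
  proof -
    have "0 \<le> v \<bullet> ((hess_xx f x s - m *\<^sub>R mat 1) *v v)"
      using lower[of x] by (simp add: loewner_ge_def psd_def)
    also have "\<dots> = v \<bullet> (hess_xx f x s *v v) - m * (norm v)\<^sup>2"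
      by (simp add: matrix_vector_mult_diff_rdistrib scaleR_matrix_vector_assoc[symmetric]
          inner_diff_right power2_norm_eq_inner)
    finally show ?thesis by simp
  qed
  show "norm (hess_xx f x s *v v) \<le> L * norm v" for x v
    using onorm[of "(*v) (hess_xx f x s)" v] mult_right_mono[OF upper[of x], of "norm v"]
    by (simp add: matrix_vector_mul_bounded_linear)
qed (use assms smooth_derivatives[OF smooth s] in auto)

section \<open>Error of one prediction-correction step\<close>

lemma grad_x_time_lipschitz:
  fixes f :: "real^'n \<Rightarrow> real \<Rightarrow> real"
  assumes smooth: "smooth_on (UNIV \<times> {0..}) (\<lambda>(x, s). f x s)"
    and bound: "\<And>s. 0 \<le> s \<Longrightarrow> norm (grad_tx f x s) \<le> c" and "0 \<le> s" "0 \<le> r"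
  shows "norm (grad_x f x s - grad_x f x r) \<le> c * \<bar>s - r\<bar>"
proof -
  have "norm (grad_x f x s - grad_x f x r) \<le> c * norm (s - r)"
  proof (rule differentiable_bound[where S = "{0..}"])
    show "((\<lambda>s. grad_x f x s) has_derivative (\<lambda>b. b *\<^sub>R grad_tx f x q)) (at q within {0..})"
      if "q \<in> {0..}" for q
      using smooth_derivatives(3)[OF smooth, of q x] that by (simp add: has_vector_derivative_def)
    show "onorm (\<lambda>b. b *\<^sub>R grad_tx f x q) \<le> c" if "q \<in> {0..}" for q
    proof (rule onorm_le)
      show "norm (b *\<^sub>R grad_tx f x q) \<le> c * norm b" for b
        using mult_right_mono[OF bound[of q], of "\<bar>b\<bar>"] that by (simp add: mult.commute)
    qed
  qed (use assms in auto)
  then show ?thesis by simp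
qed

text \<open>
  By strong convexity at time \<open>s\<close>, the distance of the two minimizers is controlled by the
  gradient at time \<open>s\<close> in the minimizer for time \<open>r\<close>. This gradient vanishes at time \<open>r\<close>
  and changes at speed at most \<open>c\<close>.
\<close>

lemma minimizer_drift_le:
  fixes f :: "real^'n \<Rightarrow> real \<Rightarrow> real"
  assumes smooth: "smooth_on (UNIV \<times> {0..}) (\<lambda>(x, s). f x s)" and "0 < m" "m \<le> L"
    and lower: "\<And>x s. 0 \<le> s \<Longrightarrow> loewner_ge (hess_xx f x s) (m *\<^sub>R mat 1)"
    and upper: "\<And>x s. 0 \<le> s \<Longrightarrow> onorm ((*v) (hess_xx f x s)) \<le> L"
    and bound: "\<And>x s. 0 \<le> s \<Longrightarrow> norm (grad_tx f x s) \<le> c" and sr: "0 \<le> s" "0 \<le> r"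
  shows "norm (minimizer f s - minimizer f r) \<le> c * \<bar>s - r\<bar> / m"
proof -
  interpret s: strongly_convex_smooth "\<lambda>x. f x s" "\<lambda>x. grad_x f x s" "\<lambda>x. (*v) (hess_xx f x s)" m L
    using assms by (intro strongly_convex_smooth_slice) auto
  interpret r: strongly_convex_smooth "\<lambda>x. f x r" "\<lambda>x. grad_x f x r" "\<lambda>x. (*v) (hess_xx f x r)" m L
    using assms by (intro strongly_convex_smooth_slice) auto
  have stationary: "grad_x f (minimizer f s) s = 0" "grad_x f (minimizer f r) r = 0"
    using s.gradient_arg_min_eq_0 r.gradient_arg_min_eq_0 by (simp_all add: minimizer_def)
  have "m * norm (minimizer f s - minimizer f r)
      \<le> norm (grad_x f (minimizer f s) s - grad_x f (minimizer f r) s)"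
    by (rule s.norm_gradient_diff_ge)
  also have "\<dots> = norm (grad_x f (minimizer f r) s - grad_x f (minimizer f r) r)"
    by (simp add: stationary)
  also have "\<dots> \<le> c * \<bar>s - r\<bar>"
    using grad_x_time_lipschitz[OF smooth] bound sr by blast
  finally show ?thesis
    using \<open>0 < m\<close> by (simp add: field_simps)
qed

text \<open>
  The constant \<open>3\<close> counts the error of the prediction, at most \<open>rate m L \<alpha> ^ P + 1 \<le> 2\<close>
  times \<open>c * h / m\<close>, and the drift of the minimizer. The correction starts with the sum of
  these errors, so \<open>rate m L \<beta> ^ C\<close> multiplies it as well.
\<close>

lemma ufopc_error_step:
  fixes f :: "real^'n \<Rightarrow> real \<Rightarrow> real"
  assumes smooth: "smooth_on (UNIV \<times> {0..}) (\<lambda>(x, s). f x s)" and m: "0 < m" "m \<le> L"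
    and lower: "\<And>x s. 0 \<le> s \<Longrightarrow> loewner_ge (hess_xx f x s) (m *\<^sub>R mat 1)"
    and upper: "\<And>x s. 0 \<le> s \<Longrightarrow> onorm ((*v) (hess_xx f x s)) \<le> L"
    and bound: "\<And>x s. 0 \<le> s \<Longrightarrow> norm (grad_tx f x s) \<le> c"
    and h: "0 < h" and t: "0 \<le> t k" "t (Suc k) = t k + h"
    and \<alpha>: "0 < \<alpha>" "\<alpha> < 2 / L" and \<beta>: "0 < \<beta>" and \<gamma>: "0 \<le> \<gamma>" "\<gamma> \<le> 1"
  shows "norm (ufopc f h t \<alpha> \<beta> \<gamma> P C x0 (Suc k) - minimizer f (t (Suc k)))
    \<le> rate m L \<beta> ^ C * (rate m L \<alpha> ^ P + (rate m L \<alpha> ^ P + 1) * (1 - \<gamma> + \<gamma> * (2 * L / m)))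
        * norm (ufopc f h t \<alpha> \<beta> \<gamma> P C x0 k - minimizer f (t k))
      + rate m L \<beta> ^ C * (3 * c * h / m)"
proof -
  define s r where "s = t k" and "r = t (Suc k)"
  have sr: "0 \<le> s" "0 \<le> r" "r - s = h"
    using t h by (simp_all add: s_def r_def)
  interpret s: strongly_convex_smooth "\<lambda>x. f x s" "\<lambda>x. grad_x f x s" "\<lambda>x. (*v) (hess_xx f x s)" m L
    using assms sr by (intro strongly_convex_smooth_slice) auto
  interpret r: strongly_convex_smooth "\<lambda>x. f x r" "\<lambda>x. grad_x f x r" "\<lambda>x. (*v) (hess_xx f x r)" m L
    using assms sr by (intro strongly_convex_smooth_slice) auto
  have stationary: "grad_x f (minimizer f s) s = 0" "grad_x f (minimizer f r) r = 0"
    using s.gradient_arg_min_eq_0 r.gradient_arg_min_eq_0 by (simp_all add: minimizer_def)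
  define x where "x = ufopc f h t \<alpha> \<beta> \<gamma> P C x0 k"
  define y where "y = (prediction_step f h \<alpha> \<gamma> x s ^^ P) x"
  define \<rho> where "\<rho> = rate m L \<alpha> ^ P"
  define \<sigma> where "\<sigma> = \<rho> + (\<rho> + 1) * (1 - \<gamma> + \<gamma> * (2 * L / m))"
  have \<rho>: "0 \<le> \<rho>" "\<rho> \<le> 1"
    using rate_nonneg rate_less_one[OF m \<alpha>] by (auto simp: \<rho>_def power_le_one)
  have "norm (h *\<^sub>R grad_tx f x s) / m \<le> c * h / m"
    using bound[of s x] sr h m by (simp add: mult.commute divide_right_mono)
  then have noise: "(\<rho> + 1) * (norm (h *\<^sub>R grad_tx f x s) / m) \<le> 2 * (c * h / m)"
    using \<rho> m h by (intro mult_mono) auto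
  have "norm (y - minimizer f s) \<le> \<sigma> * norm (x - minimizer f s)
      + (\<rho> + 1) * (norm (h *\<^sub>R grad_tx f x s) / m)"
    unfolding y_def prediction_step_def \<sigma>_def \<rho>_def
    using stationary \<alpha> \<gamma> by (intro s.prediction_error_le) auto
  moreover have "norm (minimizer f s - minimizer f r) \<le> c * h / m"
    using minimizer_drift_le[OF smooth m lower upper bound sr(1,2)] sr(3) h
    by (simp add: abs_minus_commute)
  moreover have "norm (y - minimizer f r) \<le> norm (y - minimizer f s) + norm (minimizer f s - minimizer f r)"
    using norm_triangle_ineq[of "y - minimizer f s" "minimizer f s - minimizer f r"] by simp
  ultimately have pred: "norm (y - minimizer f r) \<le> \<sigma> * norm (x - minimizer f s) + 3 * c * h / m"
    using noise by simp
  have "norm (ufopc f h t \<alpha> \<beta> \<gamma> P C x0 (Suc k) - minimizer f r)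
      = norm (((\<lambda>y. y - \<beta> *\<^sub>R grad_x f y r) ^^ C) y - minimizer f r)"
    by (simp add: Let_def y_def x_def s_def r_def correction_step_def[abs_def])
  also have "\<dots> \<le> rate m L \<beta> ^ C * norm (y - minimizer f r)"
    using stationary \<beta> by (intro r.gradient_descent_error_le) auto
  also have "\<dots> \<le> rate m L \<beta> ^ C * (\<sigma> * norm (x - minimizer f s) + 3 * c * h / m)"
    using pred by (intro mult_left_mono) (simp_all add: rate_nonneg)
  also have "\<dots> = rate m L \<beta> ^ C * \<sigma> * norm (x - minimizer f s) + rate m L \<beta> ^ C * (3 * c * h / m)"
    by (simp add: distrib_left)
  finally show ?thesis
    unfolding \<sigma>_def \<rho>_def x_def s_def r_def .
qed

section \<open>Convergence of the prediction-correction method\<close>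

theorem theorem3:
  fixes m L C\<^sub>0 \<tau>\<^sub>0 :: real
  assumes "0 < m" and "m \<le> L" and "0 \<le> C\<^sub>0" and "\<tau>\<^sub>0 < 1"
  shows "\<exists>K\<ge>0. \<forall>(f :: real^'n \<Rightarrow> real \<Rightarrow> real) (t :: nat \<Rightarrow> real) h \<alpha> \<beta> \<gamma> P C x\<^sub>0.
    smooth_on (UNIV \<times> {0..}) (\<lambda>(x, s). f x s) \<longrightarrow>
    (\<forall>x. \<forall>s\<ge>0. loewner_ge (hess_xx f x s) (m *\<^sub>R mat 1)) \<longrightarrow>
    (\<forall>x. \<forall>s\<ge>0. onorm ((*v) (hess_xx f x s)) \<le> L) \<longrightarrow>
    (\<forall>x. \<forall>s\<ge>0. norm (grad_tx f x s) \<le> C\<^sub>0) \<longrightarrow>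
    0 < h \<longrightarrow> 0 \<le> t 0 \<longrightarrow> (\<forall>k. t (Suc k) - t k = h) \<longrightarrow>
    0 < \<alpha> \<longrightarrow> \<alpha> < 2 / L \<longrightarrow> 0 < \<beta> \<longrightarrow> \<beta> < 2 / L \<longrightarrow> 0 \<le> \<gamma> \<longrightarrow> \<gamma> \<le> 1 \<longrightarrow>
    \<tau>\<^sub>0 = rate m L \<beta> ^ C *
          (rate m L \<alpha> ^ P + (rate m L \<alpha> ^ P + 1) * (1 - \<gamma> + \<gamma> * (2 * L / m))) \<longrightarrow>
    (let e = (\<lambda>k. norm (ufopc f h t \<alpha> \<beta> \<gamma> P C x\<^sub>0 k - minimizer f (t k)))
     in converges_linearly_to_error_bound e \<tau>\<^sub>0 \<and>
        limsup (\<lambda>k. ereal (e k)) \<le> ereal (K * (rate m L \<beta> ^ C * h)))"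
proof (intro exI[of _ "3 * C\<^sub>0 / (m * (1 - \<tau>\<^sub>0))"] conjI allI impI)
  show "0 \<le> 3 * C\<^sub>0 / (m * (1 - \<tau>\<^sub>0))"
    using assms by simp
next
  fix f :: "real^'n \<Rightarrow> real \<Rightarrow> real" and t :: "nat \<Rightarrow> real" and h \<alpha> \<beta> \<gamma> P C and x\<^sub>0 :: "real^'n"
  assume smooth: "smooth_on (UNIV \<times> {0..}) (\<lambda>(x, s). f x s)"
    and lower: "\<forall>x. \<forall>s\<ge>0. loewner_ge (hess_xx f x s) (m *\<^sub>R mat 1)"
    and upper: "\<forall>x. \<forall>s\<ge>0. onorm ((*v) (hess_xx f x s)) \<le> L"
    and bound: "\<forall>x. \<forall>s\<ge>0. norm (grad_tx f x s) \<le> C\<^sub>0"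
    and h: "0 < h" and t0: "0 \<le> t 0" and t_step: "\<forall>k. t (Suc k) - t k = h"
    and \<alpha>: "0 < \<alpha>" "\<alpha> < 2 / L" and \<beta>: "0 < \<beta>" and \<gamma>: "0 \<le> \<gamma>" "\<gamma> \<le> 1"
    and \<tau>\<^sub>0: "\<tau>\<^sub>0 = rate m L \<beta> ^ C *
          (rate m L \<alpha> ^ P + (rate m L \<alpha> ^ P + 1) * (1 - \<gamma> + \<gamma> * (2 * L / m)))"
  define e where "e k = norm (ufopc f h t \<alpha> \<beta> \<gamma> P C x\<^sub>0 k - minimizer f (t k))" for k
  define b where "b = rate m L \<beta> ^ C * (3 * C\<^sub>0 * h / m)"
  have b: "0 \<le> b"
    using assms h by (simp add: b_def rate_nonneg)
  have t: "0 \<le> t k" "t (Suc k) = t k + h" for k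
  proof -
    show "t (Suc k) = t k + h" for k
      using t_step by (simp add: algebra_simps)
    then show "0 \<le> t k"
      using t0 h by (induction k) auto
  qed
  have \<tau>: "0 \<le> \<tau>\<^sub>0"
    unfolding \<tau>\<^sub>0 using assms(1,2) \<gamma> rate_nonneg
    by (intro mult_nonneg_nonneg add_nonneg_nonneg) (auto intro: zero_le_power)
  have "e (Suc k) \<le> \<tau>\<^sub>0 * e k + b" for k
    unfolding e_def b_def \<tau>\<^sub>0
    using assms lower upper bound by (intro ufopc_error_step[OF smooth]) (use h t \<alpha> \<beta> \<gamma> in auto)
  then have geometric: "e k \<le> \<tau>\<^sub>0 ^ k * e 0 + b / (1 - \<tau>\<^sub>0)" for k
    using affine_recursion_le[OF \<tau> \<open>\<tau>\<^sub>0 < 1\<close> b] by blast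
  have "converges_linearly_to_error_bound e \<tau>\<^sub>0"
    unfolding converges_linearly_to_error_bound_def
    using geometric b \<open>\<tau>\<^sub>0 < 1\<close> by (intro exI[of _ "b / (1 - \<tau>\<^sub>0)"]) simp
  moreover have "b / (1 - \<tau>\<^sub>0) = 3 * C\<^sub>0 / (m * (1 - \<tau>\<^sub>0)) * (rate m L \<beta> ^ C * h)"
    by (simp add: b_def)
  ultimately show "let e = (\<lambda>k. norm (ufopc f h t \<alpha> \<beta> \<gamma> P C x\<^sub>0 k - minimizer f (t k)))
     in converges_linearly_to_error_bound e \<tau>\<^sub>0 \<and>
        limsup (\<lambda>k. ereal (e k)) \<le> ereal (3 * C\<^sub>0 / (m * (1 - \<tau>\<^sub>0)) * (rate m L \<beta> ^ C * h))"
    using limsup_le_of_geometric_bound[OF \<tau> \<open>\<tau>\<^sub>0 < 1\<close> geometric]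
    by (simp add: Let_def e_def[abs_def])
qed

end
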